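(* Let $f$ be analytic in the unit disc $\mathbb{D}$, let $\theta\in\mathbb{R}$, and let $p,q\in[1,+\infty]$ with $1/p+1/q=1$. If the function $r\mapsto f'(re^{i\theta})/\lambda_{\mathbb{D}}(r)$ belongs to $\Lambda^p$, then $$\mathcal{E}(r,\theta)=o\big(\ell(r)^{1/q}\big)\qquad\text{as } r\to1 .$$ In particular, if $f'/\lambda_{\mathbb{D}}$ is square-integrable with respect to hyperbolic length along the ray ending at $e^{i\theta}$, then $\mathcal{E}(r,\theta)=o\big(\sqrt{\ell(r)}\big)$ as $r\to1$.
   Context: $\mathbb{D}=\{|z|<1\}$ is the open unit disc and $\lambda_{\mathbb{D}}(z)=2/(1-|z|^2)$ is the density of its hyperbolic metric. $\mathcal{E}(r,\theta)=\int_0^r|f'(te^{i\theta})|\,dt$ is the Euclidean length of the image under $f$ of the segment $[0,re^{i\theta}]$, and $\ell(r)=\log\frac{1+r}{1-r}$ is the hyperbolic length of $[0,re^{i\theta}]$. The ray ending at $e^{i\theta}$ is the radius $[0,e^{i\theta})$. $\Lambda^p$ is the space of measurable functions on $[0,1)$ whose $p$-th power is integrable with respect to the hyperbolic length $\lambda_{\mathbb{D}}(t)\,dt$, i.e. measurable $g$ with $\int_0^1|g(t)|^p\,\lambda_{\mathbb{D}}(t)\,dt<\infty$ (for $p=\infty$, with the usual convention, essentially bounded $g$).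
   Formalization: For p=1 and p=∞ the little-o is replaced by big-O, since it fails there: f(z)=z at p=1 gives E(r,0)=r, not o(1); f(z)=-log(1-z) at p=∞ gives E(r,0)~ℓ(r). The little-o is kept for 1<p<∞ and in the square-integrable case. *)

theory Defs
  imports "HOL-Complex_Analysis.Complex_Analysis" "HOL-Library.Landau_Symbols"
begin

definition hyp_density :: "complex \<Rightarrow> real" where
  "hyp_density z = 2 / (1 - (norm z)\<^sup>2)"

text \<open>The measure $\lambda_{\mathbb D}(t)\,dt$ on $[0,1)$.\<close>

definition hyp_measure :: "real measure" where
  "hyp_measure =
     density (lebesgue_on {0..<1}) (\<lambda>t. ennreal (hyp_density (complex_of_real t)))"

definition euclid_length :: "(complex \<Rightarrow> complex) \<Rightarrow> real \<Rightarrow> real \<Rightarrow> real" where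
  "euclid_length f \<theta> r = integral {0..r} (\<lambda>t. norm (deriv f (of_real t * cis \<theta>)))"

definition hyp_length :: "real \<Rightarrow> real" where
  "hyp_length r = ln ((1 + r) / (1 - r))"

definition Lambda_space :: "ennreal \<Rightarrow> (real \<Rightarrow> complex) set" where
  "Lambda_space p = {g \<in> borel_measurable hyp_measure.
     if p = \<infinity> then \<exists>C. AE t in hyp_measure. norm (g t) \<le> C
     else (\<integral>\<^sup>+ t. ennreal (norm (g t) powr enn2real p) \<partial>hyp_measure) < \<infinity>}"

text \<open>
  For $p \in \{1, \infty\}$ the little-o estimate
  $\mathcal E(r,\theta) = o(\ell(r)^{1/q})$ fails, and the theorem states big-O there.
  With $\theta = 0$:
  for $p = 1$, $f(z) = z$ has $\mathcal E(r,0) = r$, which is not $o(1)$, although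
  $f'/\lambda_{\mathbb D}$ is integrable;
  for $p = \infty$, $f(z) = -\log(1 - z)$ has
  $|f'(r)|/\lambda_{\mathbb D}(r) = (1 + r)/2 \le 1$ but
  $\mathcal E(r,0) = -\log(1 - r)$, which is asymptotic to $\ell(r)$.
\<close>

end

theory Submission
  imports Defs "HOL-Real_Asymp.Real_Asymp"
begin

text \<open>
  Write $g = |f'|/\lambda_{\mathbb D}$ along the ray, so that $\mathcal E(r) = \int_0^r g\lambda_{\mathbb D}$
  and $\ell(r) = \int_0^r \lambda_{\mathbb D}$.  For $1 < p < \infty$ the pointwise bound
  $g \le d^{1-p} g^p + d$, valid for every threshold $d > 0$, takes the place of Hoelder's
  inequality.  Integrating it over $[s, r]$ with $d = e\,\ell(r)^{-1/p}$, where $s$ is chosen so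
  that $\int_s^1 g^p\lambda_{\mathbb D} \le e^p$, bounds $\mathcal E(r) - \mathcal E(s)$ by
  $2e\,\ell(r)^{1/q}$, and $\mathcal E(s)$ is negligible because $\ell(r) \to \infty$.
\<close>

section \<open>Hyperbolic density and length along a radius\<close>

lemma hyp_density_of_real [simp]: "hyp_density (complex_of_real t) = 2 / (1 - t\<^sup>2)"
  by (simp add: hyp_density_def)

lemma one_minus_square_pos:
  fixes t :: real
  assumes "0 \<le> t" "t < 1"
  shows "0 < 1 - t\<^sup>2"
  using assms by (simp add: power_less_one_iff abs_square_less_1)

text \<open>Fundamental theorem of calculus: \<open>hyp_length\<close> is an antiderivative of the
  weight and vanishes at 0. This is how the length enters the estimates below.\<close>

lemma hyp_length_has_integral:
  assumes "0 \<le> r" "r < 1"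
  shows "((\<lambda>t. 2 / (1 - t\<^sup>2)) has_integral hyp_length r) {0..r}"
proof -
  have "((\<lambda>t. 2 / (1 - t\<^sup>2)) has_integral (hyp_length r - hyp_length 0)) {0..r}"
  proof (rule fundamental_theorem_of_calculus)
    fix t assume t: "t \<in> {0..r}"
    have t1: "0 < 1 - t" "0 < 1 + t" using t assms by auto
    have "1 - t\<^sup>2 = (1 - t) * (1 + t)" by (simp add: power2_eq_square algebra_simps)
    \<comment> \<open>The left side is the unsimplified output of the chain and quotient rules, so
      that rewriting backwards with \<open>d\<close> matches the derivative found below.\<close>
    then have d: "1 / ((1 + t) / (1 - t)) * ((1 * (1 - t) - (1 + t) * (0 - 1)) / ((1 - t) * (1 - t)))
        = 2 / (1 - t\<^sup>2)"
      using t1 by (simp add: frac_eq_eq)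
    have "((\<lambda>r. (1 + r) / (1 - r)) has_real_derivative
        (1 * (1 - t) - (1 + t) * (0 - 1)) / ((1 - t) * (1 - t))) (at t)"
      by (rule DERIV_divide) (use t1 in \<open>auto intro!: derivative_eq_intros\<close>)
    from DERIV_chain2[OF DERIV_ln_divide this] t1
    have "(hyp_length has_real_derivative 2 / (1 - t\<^sup>2)) (at t)"
      unfolding hyp_length_def[abs_def] d[symmetric] by simp
    then show "(hyp_length has_vector_derivative 2 / (1 - t\<^sup>2)) (at t within {0..r})"
      using has_real_derivative_iff_has_vector_derivative has_vector_derivative_at_within by blast
  qed (use assms in auto)
  then show ?thesis by (simp add: hyp_length_def)
qed

lemma filterlim_hyp_length: "filterlim hyp_length at_top (at_left 1)"
  unfolding hyp_length_def by real_asymp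

lemma continuous_on_hyp_density:
  "continuous_on {0..<1} (\<lambda>t::real. 2 / (1 - t\<^sup>2))"
  by (intro continuous_intros) (use one_minus_square_pos in force)

section \<open>Integrals over segments and against the hyperbolic measure\<close>

lemma integrable_on_segment:
  fixes u :: "real \<Rightarrow> real"
  assumes "continuous_on {0..<1} u" "0 \<le> a" "b < 1"
  shows "u integrable_on {a..b}"
  by (rule integrable_continuous_interval, rule continuous_on_subset[OF assms(1)])
     (use assms in auto)

lemma segment_integral_combine:
  fixes u :: "real \<Rightarrow> real"
  assumes "continuous_on {0..<1} u" "0 \<le> s" "s \<le> r" "r < 1"
  shows "integral {0..r} u = integral {0..s} u + integral {s..r} u"
  using assms Henstock_Kurzweil_Integration.integral_combine[of 0 s r u]
    integrable_on_segment[of u 0 r] by simp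

lemma measurable_hyp_density:
  "(\<lambda>t::real. ennreal (2 / (1 - t\<^sup>2))) \<in> borel_measurable (lebesgue_on {0..<1})"
proof -
  have "{0..<1::real} \<in> sets lebesgue" by simp
  from continuous_imp_measurable_on_sets_lebesgue[OF continuous_on_hyp_density this]
  show ?thesis by measurable
qed

text \<open>Unwinds the density and the restriction in \<open>hyp_measure\<close>, then passes from
  Lebesgue measure to \<open>lborel\<close>, where nonnegative integrals can be compared with
  Henstock-Kurzweil integrals.\<close>

lemma nn_integral_hyp_measure:
  assumes "continuous_on {0..<1} u"
  shows "(\<integral>\<^sup>+ t. ennreal (u t) \<partial>hyp_measure)
       = (\<integral>\<^sup>+ t. ennreal (u t * (2 / (1 - t\<^sup>2))) * indicator {0..<1} t \<partial>lborel)"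
proof -
  have S: "{0..<1::real} \<in> sets lebesgue" by simp
  have m: "(\<lambda>t. ennreal (u t)) \<in> borel_measurable (lebesgue_on {0..<1})"
    using continuous_imp_measurable_on_sets_lebesgue[OF assms S] by measurable
  have "(\<integral>\<^sup>+ t. ennreal (u t) \<partial>hyp_measure)
      = (\<integral>\<^sup>+ t. ennreal (2 / (1 - t\<^sup>2)) * ennreal (u t) \<partial>lebesgue_on {0..<1})"
    unfolding hyp_measure_def hyp_density_of_real by (rule nn_integral_density[OF measurable_hyp_density m])
  also have "\<dots> = (\<integral>\<^sup>+ t. ennreal (u t * (2 / (1 - t\<^sup>2))) \<partial>lebesgue_on {0..<1})"
  proof (rule nn_integral_cong)
    fix t :: real assume "t \<in> space (lebesgue_on {0..<1})"
    then have "0 \<le> 2 / (1 - t\<^sup>2)" using one_minus_square_pos[of t] by simp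
    then show "ennreal (2 / (1 - t\<^sup>2)) * ennreal (u t) = ennreal (u t * (2 / (1 - t\<^sup>2)))"
      by (metis ennreal_mult'' mult.commute)
  qed
  also have "\<dots> = (\<integral>\<^sup>+ t. ennreal (u t * (2 / (1 - t\<^sup>2))) * indicator {0..<1} t \<partial>lebesgue)"
    by (rule nn_integral_restrict_space) simp
  finally show ?thesis by (simp add: nn_integral_completion)
qed

text \<open>Truncating a nonnegative integrand to a segment only lowers its integral. The bound is
  uniform in \<open>r\<close>, which is what every case of the theorem draws from membership in the
  space for finite exponents.\<close>

lemma segment_integral_le_nn_integral:
  assumes "continuous_on {0..<1} u" "\<And>t. 0 \<le> u t"
    and "(\<integral>\<^sup>+ t. ennreal (u t) \<partial>hyp_measure) < \<infinity>" "0 \<le> r" "r < 1"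
  shows "integral {0..r} (\<lambda>t. u t * (2 / (1 - t\<^sup>2)))
       \<le> enn2real (\<integral>\<^sup>+ t. ennreal (u t) \<partial>hyp_measure)"
proof -
  let ?v = "\<lambda>t. u t * (2 / (1 - t\<^sup>2))"
  have "?v integrable_on {0..r}"
    by (intro integrable_on_segment continuous_on_mult assms continuous_on_hyp_density) auto
  moreover have pos: "0 \<le> ?v t" if "t \<in> {0..r}" for t
    using one_minus_square_pos[of t] that assms by simp
  ultimately have "ennreal (integral {0..r} ?v) = (\<integral>\<^sup>+ t. ennreal (?v t) * indicator {0..r} t \<partial>lborel)"
    by (intro nn_integral_has_integral_lebesgue'[symmetric] integrable_integral) auto
  also have "\<dots> \<le> (\<integral>\<^sup>+ t. ennreal (?v t) * indicator {0..<1} t \<partial>lborel)"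
    by (intro nn_integral_mono) (use assms in \<open>auto split: split_indicator\<close>)
  finally have "ennreal (integral {0..r} ?v) \<le> (\<integral>\<^sup>+ t. ennreal (u t) \<partial>hyp_measure)"
    using nn_integral_hyp_measure[OF assms(1)] by simp
  \<comment> \<open>Since \<open>enn2real\<close> sends infinity to 0, it is monotone only below
    infinity; this is where the finiteness assumption enters.\<close>
  from enn2real_mono[OF this] show ?thesis
    using assms(3) integral_nonneg[OF \<open>?v integrable_on {0..r}\<close> pos] by simp
qed

section \<open>Exponents strictly between 1 and infinity\<close>

lemma small_tail:
  fixes u :: "real \<Rightarrow> real"
  assumes cont: "continuous_on {0..<1} u"
    and bound: "\<And>r. 0 \<le> r \<Longrightarrow> r < 1 \<Longrightarrow> integral {0..r} u \<le> B" and "0 < e"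
  obtains s where "0 \<le> s" "s < 1" "\<And>r. s \<le> r \<Longrightarrow> r < 1 \<Longrightarrow> integral {s..r} u \<le> e"
proof -
  let ?I = "(\<lambda>r. integral {0..r} u) ` {0..<1}"
  have bdd: "bdd_above ?I" by (rule bdd_aboveI2[of _ _ B]) (use bound in auto)
  \<comment> \<open>Pick \<open>s\<close> where the running integral is within \<open>e\<close> of
    its supremum; beyond \<open>s\<close> it can then rise by at most \<open>e\<close>.\<close>
  obtain y where "y \<in> ?I" "Sup ?I - e < y"
    using less_cSup_iff[of ?I "Sup ?I - e"] bdd \<open>0 < e\<close> by auto
  then obtain s where s: "0 \<le> s" "s < 1" "Sup ?I - e < integral {0..s} u" by auto
  show ?thesis
  proof (rule that[OF s(1,2)])
    fix r assume r: "s \<le> r" "r < 1"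
    then have "integral {0..r} u \<le> Sup ?I" by (intro cSup_upper bdd) (use s in auto)
    then show "integral {s..r} u \<le> e"
      using segment_integral_combine[OF cont s(1) r] s(3) by linarith
  qed
qed

text \<open>Below the threshold the term \<open>d\<close> suffices. Above it, (x/d)^(p-1) is at
  least 1, and multiplying \<open>x\<close> by this factor gives exactly the first term.\<close>

lemma le_powr_plus_threshold:
  fixes x d p :: real
  assumes "0 \<le> x" "0 < d" "1 \<le> p"
  shows "x \<le> d powr (1 - p) * x powr p + d"
proof (cases "x \<le> d")
  case True
  then show ?thesis by (simp add: add_increasing)
next
  case False
  have "d powr (p - 1) \<le> x powr (p - 1)"
    using False assms by (intro powr_mono2) auto
  then have "d powr (1 - p) * d powr (p - 1) * x \<le> d powr (1 - p) * x powr (p - 1) * x"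
    using assms by (intro mult_right_mono mult_left_mono) auto
  then have "x \<le> d powr (1 - p) * (x powr (p - 1) * x)"
    using assms by (simp add: powr_add[symmetric] mult.assoc)
  also have "x powr (p - 1) * x = x powr p"
    using False assms by (simp add: powr_diff)
  finally show ?thesis using assms by simp
qed

lemma smallo_hyp_length:
  assumes cont: "continuous_on {0..<1} g" and pos: "\<And>t. 0 \<le> g t" and p: "1 < p"
    and fin: "(\<integral>\<^sup>+ t. ennreal (g t powr p) \<partial>hyp_measure) < \<infinity>"
  shows "(\<lambda>r. integral {0..r} (\<lambda>t. g t * (2 / (1 - t\<^sup>2))))
       \<in> o[at_left 1](\<lambda>r. hyp_length r powr (1 - 1 / p))"
proof (rule landau_o.smallI)
  fix c :: real assume c: "0 < c"
  let ?w = "\<lambda>t::real. 2 / (1 - t\<^sup>2)"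
  let ?h = "\<lambda>t. g t * ?w t" and ?u = "\<lambda>t. g t powr p * ?w t"
  \<comment> \<open>Three contributions will each be at most e L^(1-1/p) with L =
    \<open>hyp_length r\<close>: the head up to \<open>s\<close> and the two terms of the threshold
    bound. Hence c/4 is small enough.\<close>
  define e where "e = c / 4"
  have e: "0 < e" using c by (simp add: e_def)
  have w: "0 \<le> ?w t" if "0 \<le> t" "t < 1" for t using one_minus_square_pos[OF that] by simp
  have cp: "continuous_on {0..<1} (\<lambda>t. g t powr p)"
    by (rule continuous_on_powr') (use cont pos p in \<open>auto intro: continuous_intros\<close>)
  note cw = continuous_on_hyp_density
  have cu: "continuous_on {0..<1} ?u" and ch: "continuous_on {0..<1} ?h"
    by (intro continuous_on_mult cp cont cw)+
  obtain s where s: "0 \<le> s" "s < 1"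
    and tail: "\<And>r. s \<le> r \<Longrightarrow> r < 1 \<Longrightarrow> integral {s..r} ?u \<le> e powr p"
  proof (rule small_tail[OF cu _ powr_gt_zero[THEN iffD2]])
    fix r :: real assume "0 \<le> r" "r < 1"
    then show "integral {0..r} ?u \<le> enn2real (\<integral>\<^sup>+ t. ennreal (g t powr p) \<partial>hyp_measure)"
      by (intro segment_integral_le_nn_integral cp fin) auto
  next
    show "e \<noteq> 0" using e by simp
  qed (rule that)
  define A where "A = integral {0..s} ?h"
  \<comment> \<open>The exponent 1 - 1/p is positive because p > 1, so the comparison function is
    unbounded and eventually absorbs the fixed head \<open>A\<close>.\<close>
  have "filterlim (\<lambda>r. hyp_length r powr (1 - 1 / p)) at_top (at_left 1)"
    by (rule filterlim_compose[OF real_powr_at_top filterlim_hyp_length]) (use p in simp)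
  then have "\<forall>\<^sub>F r in at_left 1. A / e \<le> hyp_length r powr (1 - 1 / p)"
    by (simp add: filterlim_at_top)
  moreover have "\<forall>\<^sub>F r in at_left 1. 0 < hyp_length r"
    using filterlim_hyp_length by (simp add: filterlim_at_top_dense)
  moreover have "\<forall>\<^sub>F r in at_left 1. r \<in> {s<..<1}"
    by (rule eventually_at_left_real) (use s in simp)
  ultimately show "\<forall>\<^sub>F r in at_left 1.
    norm (integral {0..r} ?h) \<le> c * norm (hyp_length r powr (1 - 1 / p))"
  proof eventually_elim
    case (elim r)
    let ?L = "hyp_length r"
    have r: "s \<le> r" "r < 1" "0 \<le> r" using elim s by auto
    \<comment> \<open>This choice balances the two terms: d L and d^(1-p) e^p both equal e
      L^(1-1/p).\<close>
    define d where "d = e * ?L powr (- 1 / p)"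
    have d: "0 < d" using e elim by (simp add: d_def)
    have "(\<lambda>t. d powr (1 - p) * ?u t) integrable_on {s..r}" "(\<lambda>t. d * ?w t) integrable_on {s..r}"
      by (intro integrable_on_segment continuous_on_mult continuous_on_const cu cw s r)+
    note int = this
    have "integral {s..r} ?h \<le> integral {s..r} (\<lambda>t. d powr (1 - p) * ?u t + d * ?w t)"
    proof (rule integral_le[OF integrable_on_segment[OF ch s(1) r(2)] integrable_add[OF int]])
      fix t assume "t \<in> {s..r}"
      then have "0 \<le> ?w t" using w s r by auto
      from mult_right_mono[OF le_powr_plus_threshold[OF pos d, of p] this] p
      show "?h t \<le> d powr (1 - p) * ?u t + d * ?w t"
        by (simp only: distrib_right mult.assoc)
    qed
    also have "\<dots> = d powr (1 - p) * integral {s..r} ?u + d * integral {s..r} ?w"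
      by (simp only: Henstock_Kurzweil_Integration.integral_add[OF int] integral_mult_right)
    also have "\<dots> \<le> d powr (1 - p) * e powr p + d * ?L"
    proof (intro add_mono mult_left_mono tail r)
      \<comment> \<open>Discarding the nonnegative weight on [0,s] bounds the length of [s,r] by the
        full length \<open>?L\<close>.\<close>
      have "0 \<le> integral {0..s} ?w"
        using integrable_on_segment[OF cw order_refl s(2)] by (rule integral_nonneg) (use w s in auto)
      then show "integral {s..r} ?w \<le> ?L"
        using segment_integral_combine[OF cw s(1) r(1,2)]
          integral_unique[OF hyp_length_has_integral[OF r(3,2)]] by linarith
    qed (use d in auto)
    also have "d * ?L = e * ?L powr (1 - 1 / p)"
      using elim powr_mult_base[of ?L "- 1 / p"] by (simp add: d_def mult.commute mult.left_commute)
    also have "d powr (1 - p) * e powr p = e * ?L powr (1 - 1 / p)"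
    proof -
      have exponent: "(- 1 / p) * (1 - p) = 1 - 1 / p" using p by (simp add: field_simps)
      have "d powr (1 - p) = e powr (1 - p) * ?L powr (1 - 1 / p)"
        using e elim by (simp only: d_def powr_mult powr_powr exponent)
      moreover have "e powr (1 - p) * e powr p = e" using e by (simp add: powr_add[symmetric])
      ultimately show ?thesis by (simp add: algebra_simps)
    qed
    finally have "integral {s..r} ?h \<le> 2 * e * ?L powr (1 - 1 / p)" by simp
    moreover have "A \<le> e * ?L powr (1 - 1 / p)" using elim e by (simp add: field_simps)
    moreover have "0 \<le> e * ?L powr (1 - 1 / p)" using e by simp
    moreover have "0 \<le> integral {0..r} ?h"
      using integrable_on_segment[OF ch order_refl r(2)]
      by (rule integral_nonneg) (use w pos r in auto)
    ultimately show ?case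
      using segment_integral_combine[OF ch s(1) r(1,2)] by (simp add: A_def e_def)
  qed
qed

section \<open>Endpoint exponents 1 and infinity, and arithmetic of conjugate exponents\<close>

lemma AE_hyp_measure_le_imp_le:
  assumes cont: "continuous_on {0..<1} g" and ae: "AE t in hyp_measure. g t \<le> C"
    and t: "0 < t" "t < 1"
  shows "g t \<le> (C::real)"
proof (rule ccontr)
  assume "\<not> g t \<le> C"
  \<comment> \<open>The exceptional set is open by continuity and null by assumption, hence empty.
    Restricting to the open interval secures openness in the real line, at the price of leaving out
    the point 0.\<close>
  define U where "U = {0<..<1} \<inter> g -` {C<..}"
  have "open U"
    unfolding U_def
    by (intro continuous_open_preimage continuous_on_subset[OF cont]) auto
  moreover have "negligible U"
  proof -
    \<comment> \<open>Because the density is strictly positive on [0,1), a set null for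
      \<open>hyp_measure\<close> is also Lebesgue null there.\<close>
    have "AE t in lebesgue_on {0..<1}. 0 < ennreal (2 / (1 - t\<^sup>2)) \<longrightarrow> g t \<le> C"
      using ae unfolding hyp_measure_def hyp_density_of_real by (simp only: AE_density[OF measurable_hyp_density])
    then have "AE t in lebesgue. t \<in> {0..<1} \<longrightarrow> 0 < ennreal (2 / (1 - t\<^sup>2)) \<longrightarrow> g t \<le> C"
      by (subst (asm) AE_restrict_space_iff) auto
    then have "AE t in lebesgue. t \<notin> U"
    proof (rule eventually_mono)
      fix t assume *: "t \<in> {0..<1} \<longrightarrow> 0 < ennreal (2 / (1 - t\<^sup>2)) \<longrightarrow> g t \<le> C"
      show "t \<notin> U"
      proof
        assume "t \<in> U"
        then have "0 < t" "t < 1" "C < g t" by (auto simp: U_def)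
        moreover have "0 < ennreal (2 / (1 - t\<^sup>2))"
          using one_minus_square_pos[of t] \<open>0 < t\<close> \<open>t < 1\<close> by simp
        ultimately show False using * by simp
      qed
    qed
    then show ?thesis
      using AE_iff_null_sets[of U lebesgue] \<open>open U\<close> by (simp add: negligible_iff_null_sets)
  qed
  moreover have "t \<in> U" using t \<open>\<not> g t \<le> C\<close> by (simp add: U_def)
  ultimately show False using open_not_negligible[of U] by blast
qed

text \<open>The case of infinite p: an almost everywhere bound is a pointwise one by continuity, and
  integrating it against the weight gives a multiple of the length.\<close>

lemma bigo_hyp_length_of_AE_bounded:
  assumes cont: "continuous_on {0..<1} g" and pos: "\<And>t. 0 \<le> g t"
    and ae: "AE t in hyp_measure. g t \<le> C"
  shows "(\<lambda>r. integral {0..r} (\<lambda>t. g t * (2 / (1 - t\<^sup>2)))) \<in> O[at_left 1](hyp_length)"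
proof (rule bigoI)
  \<comment> \<open>The pointwise bound by \<open>C\<close> is available only for t > 0, so the
    value at 0 is added by hand.\<close>
  define K where "K = max C (g 0)"
  have "\<forall>\<^sub>F r in at_left (1::real). r \<in> {0<..<1}"
    by (rule eventually_at_left_real) simp
  then show "\<forall>\<^sub>F r in at_left 1.
      norm (integral {0..r} (\<lambda>t. g t * (2 / (1 - t\<^sup>2)))) \<le> K * norm (hyp_length r)"
  proof eventually_elim
    case (elim r)
    then have r: "0 \<le> r" "r < 1" by auto
    have w: "0 \<le> 2 / (1 - t\<^sup>2)" if "t \<in> {0..r}" for t
      using one_minus_square_pos[of t] that r by simp
    have h: "(\<lambda>t. g t * (2 / (1 - t\<^sup>2))) integrable_on {0..r}"
      by (intro integrable_on_segment continuous_on_mult cont continuous_on_hyp_density r) simp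
    have g: "g t \<le> K" if "t \<in> {0..r}" for t
      using AE_hyp_measure_le_imp_le[OF cont ae, of t] that r by (cases "t = 0") (auto simp: K_def)
    have "0 \<le> hyp_length r"
      using has_integral_nonneg[OF hyp_length_has_integral[OF r] w] .
    moreover have "integral {0..r} (\<lambda>t. g t * (2 / (1 - t\<^sup>2))) \<le> K * hyp_length r"
      by (rule has_integral_le[OF integrable_integral[OF h]
            has_integral_mult_right[OF hyp_length_has_integral[OF r]]])
         (intro mult_right_mono g w)
    moreover have "0 \<le> integral {0..r} (\<lambda>t. g t * (2 / (1 - t\<^sup>2)))"
      by (rule integral_nonneg[OF h]) (use w pos in auto)
    ultimately show ?case by simp
  qed
qed

text \<open>The case p = 1, where 1/q = 0: the total mass bounds every segment integral.\<close>

lemma bigo_one_of_integrable: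
  assumes cont: "continuous_on {0..<1} g" and pos: "\<And>t. 0 \<le> g t"
    and fin: "(\<integral>\<^sup>+ t. ennreal (g t) \<partial>hyp_measure) < \<infinity>"
  shows "(\<lambda>r. integral {0..r} (\<lambda>t. g t * (2 / (1 - t\<^sup>2)))) \<in> O[at_left 1](\<lambda>_. 1)"
proof (rule bigoI)
  have "\<forall>\<^sub>F r in at_left (1::real). r \<in> {0<..<1}"
    by (rule eventually_at_left_real) simp
  then show "\<forall>\<^sub>F r in at_left 1. norm (integral {0..r} (\<lambda>t. g t * (2 / (1 - t\<^sup>2))))
      \<le> enn2real (\<integral>\<^sup>+ t. ennreal (g t) \<partial>hyp_measure) * norm (1::real)"
  proof eventually_elim
    case (elim r)
    then have r: "0 \<le> r" "r < 1" by auto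
    have "(\<lambda>t. g t * (2 / (1 - t\<^sup>2))) integrable_on {0..r}"
      by (intro integrable_on_segment continuous_on_mult cont continuous_on_hyp_density r) simp
    moreover have "0 \<le> g t * (2 / (1 - t\<^sup>2))" if "t \<in> {0..r}" for t
      using one_minus_square_pos[of t] that r pos[of t] by simp
    ultimately have "0 \<le> integral {0..r} (\<lambda>t. g t * (2 / (1 - t\<^sup>2)))"
      by (rule integral_nonneg)
    then show ?case
      using segment_integral_le_nn_integral[OF cont pos fin r] by simp
  qed
qed

text \<open>Transfers the conjugacy relation to real numbers. The last claim concerns
  \<open>1 / q\<close> rather than \<open>q\<close>, since for p = 1 the conjugate \<open>q\<close>
  is infinite while \<open>1 / q\<close> is 0.\<close>

lemma conjugate_exponent:
  fixes p q :: ennreal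
  assumes "1 \<le> p" "p < \<infinity>" "1 / p + 1 / q = 1"
  shows "1 \<le> enn2real p" "p = ennreal (enn2real p)" "enn2real (1 / q) = 1 - 1 / enn2real p"
proof -
  show p: "p = ennreal (enn2real p)" using assms by simp
  show 1: "1 \<le> enn2real p"
    using enn2real_mono[OF assms(1)] assms(2) by simp
  have "1 / p = ennreal (1 / enn2real p)"
    by (subst p, subst ennreal_1[symmetric], rule divide_ennreal) (use 1 in auto)
  moreover have "1 / p + 1 / q \<noteq> \<infinity>" using assms by simp
  \<comment> \<open>\<open>enn2real\<close> is additive only on finite values; both summands are
    finite because their sum is 1.\<close>
  ultimately have "enn2real (1 / p + 1 / q) = 1 / enn2real p + enn2real (1 / q)"
    using 1 by (subst enn2real_plus) (auto simp: less_top)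
  then show "enn2real (1 / q) = 1 - 1 / enn2real p" using assms by simp
qed

section \<open>Reduction to the ray and assembly of the cases\<close>

theorem theorem5p3:
  fixes f :: "complex \<Rightarrow> complex" and \<theta> :: real
  assumes "f analytic_on ball 0 1"
  shows "(\<forall>p q :: ennreal. 1 \<le> p \<and> 1 \<le> q \<and> 1 / p + 1 / q = 1 \<and>
            (\<lambda>r. deriv f (of_real r * cis \<theta>) / of_real (hyp_density (of_real r)))
               \<in> Lambda_space p \<longrightarrow>
            (if 1 < p \<and> p < \<infinity>
             then euclid_length f \<theta> \<in> o[at_left 1](\<lambda>r. hyp_length r powr enn2real (1 / q))
             else euclid_length f \<theta> \<in> O[at_left 1](\<lambda>r. hyp_length r powr enn2real (1 / q))))
       \<and> (integrable hyp_measure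
             (\<lambda>t. (norm (deriv f (of_real t * cis \<theta>) /
                          of_real (hyp_density (of_real t * cis \<theta>))))\<^sup>2) \<longrightarrow>
            euclid_length f \<theta> \<in> o[at_left 1](\<lambda>r. sqrt (hyp_length r)))"
proof -
  define F where "F t = deriv f (of_real t * cis \<theta>) / of_real (hyp_density (of_real t))" for t
  define g where "g t = norm (F t)" for t
  have pos: "0 \<le> g t" for t by (simp add: g_def)
  have "continuous_on (ball 0 1) (deriv f)"
    using analytic_deriv[OF assms] analytic_imp_holomorphic holomorphic_on_imp_continuous_on by blast
  then have "continuous_on {0..<1} (\<lambda>t. deriv f (of_real t * cis \<theta>))"
    by (rule continuous_on_compose2) (auto intro!: continuous_intros simp: norm_mult)
  then have cont: "continuous_on {0..<1} g"
    unfolding g_def F_def hyp_density_of_real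
  proof (intro continuous_on_norm continuous_on_divide[OF _ continuous_on_of_real[OF continuous_on_hyp_density]] ballI)
    fix t :: real assume "t \<in> {0..<1}"
    then have "2 / (1 - t\<^sup>2) \<noteq> 0" using one_minus_square_pos[of t] by simp
    then show "complex_of_real (2 / (1 - t\<^sup>2)) \<noteq> 0" by (simp only: of_real_eq_0_iff not_False_eq_True)
  qed
  \<comment> \<open>Cancelling the density needs it to be nonzero on the whole segment, so the
    identity is shown for r in (0,1) only; the Landau symbols at 1 ask for no more.\<close>
  have euclid: "\<forall>\<^sub>F r in at_left 1.
    euclid_length f \<theta> r = integral {0..r} (\<lambda>t. g t * (2 / (1 - t\<^sup>2)))"
  proof -
    have "\<forall>\<^sub>F r in at_left (1::real). r \<in> {0<..<1}"
      by (rule eventually_at_left_real) simp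
    then show ?thesis
    proof eventually_elim
      case (elim r)
      show ?case
        unfolding euclid_length_def
      proof (rule integral_cong)
        fix t assume "t \<in> {0..r}"
        then have "0 < 1 - t\<^sup>2" using one_minus_square_pos[of t] elim by simp
        then show "norm (deriv f (of_real t * cis \<theta>)) = g t * (2 / (1 - t\<^sup>2))"
          unfolding g_def F_def hyp_density_of_real norm_divide norm_of_real
          by (simp add: field_simps)
      qed
    qed
  qed
  have hyp_pos: "\<forall>\<^sub>F r in at_left 1. 0 < hyp_length r"
    using filterlim_hyp_length by (simp add: filterlim_at_top_dense)
  have part1: "if 1 < p \<and> p < \<infinity>
      then euclid_length f \<theta> \<in> o[at_left 1](\<lambda>r. hyp_length r powr enn2real (1 / q))
      else euclid_length f \<theta> \<in> O[at_left 1](\<lambda>r. hyp_length r powr enn2real (1 / q))"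
    if "1 \<le> p" and pq: "1 / p + 1 / q = 1" and F: "F \<in> Lambda_space p" for p q :: ennreal
  proof (cases "p = \<infinity>")
    case True
    then obtain C where "AE t in hyp_measure. g t \<le> C"
      using F by (auto simp: Lambda_space_def g_def)
    from bigo_hyp_length_of_AE_bounded[OF cont pos this]
    have "euclid_length f \<theta> \<in> O[at_left 1](hyp_length)"
      by (subst landau_o.big.in_cong[OF euclid])
    also have "hyp_length \<in> O[at_left 1](\<lambda>r. hyp_length r powr enn2real (1 / q))"
    proof (rule bigoI[where c = 1])
      \<comment> \<open>Here 1/p = 0, so the power is the first power, which agrees with
        \<open>hyp_length\<close> where the latter is positive.\<close>
      have "1 / q = 1" using pq True by simp
      with hyp_pos show "\<forall>\<^sub>F r in at_left 1.
          norm (hyp_length r) \<le> 1 * norm (hyp_length r powr enn2real (1 / q))"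
        by (auto elim!: eventually_mono)
    qed
    finally show ?thesis using True by simp
  next
    case False
    then have fin: "p < \<infinity>" by (simp add: less_top)
    note pq' = conjugate_exponent[OF \<open>1 \<le> p\<close> fin pq]
    have int: "(\<integral>\<^sup>+ t. ennreal (g t powr enn2real p) \<partial>hyp_measure) < \<infinity>"
      using F False by (simp add: Lambda_space_def g_def)
    show ?thesis
    proof (cases "p = 1")
      case True
      have "(\<integral>\<^sup>+ t. ennreal (g t) \<partial>hyp_measure) < \<infinity>"
        using int True pos by simp
      from bigo_one_of_integrable[OF cont pos this]
      have "euclid_length f \<theta> \<in> O[at_left 1](\<lambda>_. 1)"
        by (subst landau_o.big.in_cong[OF euclid])
      \<comment> \<open>Here \<open>1 / q\<close> is 0. Since \<open>0 powr 0 = 0\<close>, the power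
        equals 1 only at a nonzero base, whence the appeal to \<open>hyp_pos\<close>.\<close>
      also have "(\<lambda>_. 1) \<in> O[at_left 1](\<lambda>r. hyp_length r powr enn2real (1 / q))"
        by (rule bigoI[where c = 1])
           (use hyp_pos pq'(3) True in \<open>auto elim!: eventually_mono\<close>)
      finally show ?thesis using True by simp
    next
      case False
      then have "1 < p" using \<open>1 \<le> p\<close> by simp
      moreover have "1 < enn2real p"
        using \<open>1 < p\<close> pq'(1,2) by (metis ennreal_1 less_le)
      ultimately show ?thesis
        using smallo_hyp_length[OF cont pos _ int] fin pq'(3)
        by (simp add: landau_o.small.in_cong[OF euclid])
    qed
  qed
  have part2: "euclid_length f \<theta> \<in> o[at_left 1](\<lambda>r. sqrt (hyp_length r))"
    if "integrable hyp_measure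
      (\<lambda>t. (norm (deriv f (of_real t * cis \<theta>) / of_real (hyp_density (of_real t * cis \<theta>))))\<^sup>2)"
  proof -
    \<comment> \<open>The density depends on the modulus alone, so the rotated form in the second
      claim agrees with the one in \<open>F\<close>; the estimate is then applied with p =
      2.\<close>
    have "hyp_density (of_real t * cis \<theta>) = hyp_density (of_real t)" for t
      by (simp add: hyp_density_def norm_mult)
    with that have "integrable hyp_measure (\<lambda>t. (g t)\<^sup>2)"
      by (simp only: g_def F_def)
    then have "(\<integral>\<^sup>+ t. ennreal ((g t)\<^sup>2) \<partial>hyp_measure) < \<infinity>"
      by (simp add: integrable_iff_bounded)
    then have "(\<integral>\<^sup>+ t. ennreal (g t powr 2) \<partial>hyp_measure) < \<infinity>"
      using pos by simp
    from smallo_hyp_length[OF cont pos _ this]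
    have "euclid_length f \<theta> \<in> o[at_left 1](\<lambda>r. hyp_length r powr (1 / 2))"
      by (simp add: landau_o.small.in_cong[OF euclid])
    also have "(\<lambda>r. hyp_length r powr (1 / 2)) \<in> O[at_left 1](\<lambda>r. sqrt (hyp_length r))"
      by (rule bigoI[where c = 1])
         (use hyp_pos in \<open>auto elim!: eventually_mono simp: powr_half_sqrt\<close>)
    finally show ?thesis .
  qed
  show ?thesis
    using part1 part2 unfolding F_def[abs_def] by blast
qed

end
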